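(* Let $\mathcal{H}$ be a real Hilbert space and $Y\subset \mathcal{H}$ a nonempty closed convex set. Suppose that $J:\mathcal{H} \to \mathbb{R}$ is a Fréchet differentiable function such that $\nabla J$ is Lipschitzian on $\mathcal{H}$, with Lipschitz constant $L$, and that there is a point $x_*\in \mathcal{H}$ with $J(x_* )\leq J(x)$ for all $x\in \mathcal{H}$. Define $\mathcal{L}(x,y):= J(x+y)-\frac{L}{2}\|y\|^2$ for $x,y\in\mathcal{H}$. Then $$\inf_{x\in \mathcal{H}} J(x) -\frac{L}{2}\inf_{y\in Y}\|y\|^2= \inf_{x\in \mathcal{H}}\, \sup_{y\in Y} \left(J(x+y)-\frac{L}{2}\|y\|^2\right),$$ which is equivalent to $$\sup_{y\in Y}\,\inf_{x\in\mathcal{H}}\mathcal{L}(x,y)=\inf_{x\in \mathcal{H}}\,\sup_{y\in Y}\mathcal{L}(x,y).$$ Moreover, $\mathcal{L}$ possesses a saddle point, that is, there exists $(\bar{x},\bar{y})\in \mathcal{H}\times Y$ such that $$\mathcal{L}(\bar{x},y) \leq \mathcal{L}(\bar{x},\bar{y})\leq \mathcal{L}(x,\bar{y})\quad\text{for all } (x,y)\in \mathcal{H}\times Y.$$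
   Context: $\|\cdot\|$ is the norm induced by the inner product of $\mathcal{H}$, and $\nabla J(x)\in\mathcal{H}$ is the gradient (the Riesz representative of the Fréchet derivative) of $J$ at $x$. "$\nabla J$ is Lipschitzian with Lipschitz constant $L$" means $\|\nabla J(x)-\nabla J(x')\|\leq L\|x-x'\|$ for all $x,x'\in\mathcal{H}$. Suprema and infima are taken in the extended real line $[-\infty,+\infty]$. *)

theory Defs
  imports "HOL-Analysis.Analysis"
begin

text \<open>A real Hilbert space is a type of sort \<open>{real_inner, complete_space}\<close>.
  \<open>GDERIV J x :> g\<close> says that \<open>\<lambda>h. inner h g\<close> is the Frechet derivative of \<open>J\<close> at \<open>x\<close>, so
  \<open>gradient J x\<close> is its Riesz representative. It is meaningful only where \<open>J\<close> is differentiable;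
  at such points \<open>g\<close> exists by the Riesz theorem and is unique.\<close>

definition gradient :: "('a::{real_inner,complete_space} \<Rightarrow> real) \<Rightarrow> 'a \<Rightarrow> 'a" where
  "gradient J x = (THE g. GDERIV J x :> g)"

lemma gradient_eqI:
  assumes "GDERIV J x :> g"
  shows "gradient J x = g"
  unfolding gradient_def
proof (rule the_equality)
  fix g' assume "GDERIV J x :> g'"
  with assms have "(\<lambda>h. inner h g') = (\<lambda>h. inner h g)"
    unfolding gderiv_def by (rule has_derivative_unique[rotated])
  then have "inner (g' - g) (g' - g) = 0"
    by (metis inner_diff_right right_minus_eq)
  then show "g' = g" by simp
qed (rule assms)

definition Lagr :: "('a::{real_inner,complete_space} \<Rightarrow> real) \<Rightarrow> real \<Rightarrow> 'a \<Rightarrow> 'a \<Rightarrow> real" where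
  "Lagr J L x y = J (x + y) - L / 2 * (norm y)\<^sup>2"

end

theory Submission
  imports Defs
begin

text \<open>At a global minimiser \<open>xs\<close> the gradient vanishes, so the Lipschitz bound on the gradient
  gives \<open>J (xs + h) \<le> J xs + L/2 * \<parallel>h\<parallel>\<^sup>2\<close> (\<open>descent_lemma\<close>). Let \<open>ybar\<close> be the point of \<open>Y\<close> of
  least norm and put \<open>xbar = xs - ybar\<close>. For \<open>y \<in> Y\<close> the value \<open>Lagr J L xbar y\<close> is then at most
  \<open>J xs + L/2 * (\<parallel>y - ybar\<parallel>\<^sup>2 - \<parallel>y\<parallel>\<^sup>2)\<close>, and since \<open>\<langle>ybar, y - ybar\<rangle> \<ge> 0\<close>, the generalised
  Pythagorean inequality \<open>\<parallel>y - ybar\<parallel>\<^sup>2 \<le> \<parallel>y\<parallel>\<^sup>2 - \<parallel>ybar\<parallel>\<^sup>2\<close> bounds this by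
  \<open>J xs - L/2 * \<parallel>ybar\<parallel>\<^sup>2 = Lagr J L xbar ybar\<close>. In the other variable,
  \<open>Lagr J L xbar ybar \<le> Lagr J L x ybar\<close> is just the minimality of \<open>J xs\<close>. Hence \<open>(xbar, ybar)\<close> is
  a saddle point, and both sides of each claimed identity equal the saddle value
  (\<open>saddle_point_minimax\<close>).

  The gradient of a Frechet differentiable function on an infinite-dimensional Hilbert space exists
  by the Riesz representation theorem. Its proof rests, like the choice of \<open>ybar\<close>, on least-norm
  points of closed convex sets (\<open>least_norm_point\<close>).\<close>

text \<open>Points of nearly least norm form sets of small diameter: by the parallelogram law, two such
  points that are far apart would have a midpoint of too small norm. Completeness then provides
  the minimiser. The first-order condition comes from moving from \<open>p\<close> towards \<open>y\<close> inside \<open>C\<close>.\<close>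

lemma least_norm_point:
  fixes C :: "'a::{real_inner,complete_space} set"
  assumes "C \<noteq> {}" "closed C" "convex C"
  shows "\<exists>p\<in>C. (\<forall>y\<in>C. norm p \<le> norm y) \<and> (\<forall>y\<in>C. 0 \<le> inner p (y - p))"
proof -
  define d where "d = (INF y\<in>C. (norm y)\<^sup>2)"
  have bdd: "bdd_below ((\<lambda>y. (norm y)\<^sup>2) ` C)"
    by (rule bdd_belowI2[of _ 0]) simp
  have d_le: "d \<le> (norm y)\<^sup>2" if "y \<in> C" for y
    unfolding d_def using bdd that by (rule cINF_lower)
  define S where "S n = {y \<in> C. (norm y)\<^sup>2 \<le> d + inverse (real (Suc n))}" for n
  have "\<exists>a. \<Inter>(range S) = {a}"
  proof (rule decreasing_closed_nest_sing)
    show "closed (S n)" for n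
    proof -
      have "closed {y::'a. (norm y)\<^sup>2 \<le> d + inverse (real (Suc n))}"
        by (intro closed_Collect_le continuous_intros)
      then show ?thesis
        unfolding S_def using closed_Int[OF \<open>closed C\<close>] by (simp add: Collect_conj_eq)
    qed
    show "S n \<noteq> {}" for n
    proof -
      have "(INF y\<in>C. (norm y)\<^sup>2) < d + inverse (real (Suc n))"
        unfolding d_def[symmetric] by simp
      then obtain y where "y \<in> C" "(norm y)\<^sup>2 < d + inverse (real (Suc n))"
        using cINF_less_iff[OF \<open>C \<noteq> {}\<close> bdd] by blast
      then show ?thesis unfolding S_def by auto
    qed
    show "S n \<subseteq> S m" if "m \<le> n" for m n
    proof -
      have "inverse (real (Suc n)) \<le> inverse (real (Suc m))"
        using that by (intro le_imp_inverse_le) auto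
      then have "d + inverse (real (Suc n)) \<le> d + inverse (real (Suc m))"
        by (rule add_left_mono)
      then show ?thesis unfolding S_def by (blast intro: order_trans)
    qed
    show "\<exists>n. \<forall>x\<in>S n. \<forall>y\<in>S n. dist x y < e" if "e > 0" for e
    proof -
      have "0 < e\<^sup>2 / 4" using that by simp
      then obtain n where n: "inverse (real (Suc n)) < e\<^sup>2 / 4"
        using reals_Archimedean by blast
      have "dist x y < e" if xy: "x \<in> S n" "y \<in> S n" for x y
      proof -
        have mid: "(1/2) *\<^sub>R x + (1/2) *\<^sub>R y \<in> C"
          using xy \<open>convex C\<close> unfolding S_def by (intro convexD) auto
        have "(dist x y)\<^sup>2
            = 2 * (norm x)\<^sup>2 + 2 * (norm y)\<^sup>2 - 4 * (norm ((1/2) *\<^sub>R x + (1/2) *\<^sub>R y))\<^sup>2"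
          unfolding dist_norm power2_norm_eq_inner
          by (simp add: inner_simps inner_commute field_simps)
        also have "\<dots> \<le> 4 * inverse (real (Suc n))"
          using d_le[OF mid] xy unfolding S_def by simp
        also have "\<dots> < e\<^sup>2" using n by simp
        finally show ?thesis
          using \<open>e > 0\<close> by (auto intro: power2_less_imp_less)
      qed
      then show ?thesis by blast
    qed
  qed
  then obtain p where p: "\<And>n. p \<in> S n" by blast
  then have "p \<in> C" unfolding S_def by blast
  have "(norm p)\<^sup>2 \<le> d"
  proof (rule field_le_epsilon)
    fix e :: real assume "0 < e"
    then obtain n where "inverse (real (Suc n)) < e" using reals_Archimedean by blast
    with p[of n] show "(norm p)\<^sup>2 \<le> d + e" unfolding S_def by simp
  qed
  then have le: "norm p \<le> norm y" if "y \<in> C" for y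
    using order_trans[OF _ d_le[OF that]] by (auto intro: power2_le_imp_le)
  have "0 \<le> inner p (y - p)" if "y \<in> C" for y
    using any_closest_point_dot[OF \<open>convex C\<close> \<open>closed C\<close> \<open>p \<in> C\<close> that, of 0] le
    by simp
  with \<open>p \<in> C\<close> le show ?thesis by blast
qed

text \<open>If \<open>f\<close> is not zero, the least-norm point \<open>p\<close> of the hyperplane \<open>f x = 1\<close> is orthogonal to
  the kernel of \<open>f\<close>. As \<open>x - f x *\<^sub>R p\<close> lies in that kernel, \<open>f\<close> is the inner product with
  \<open>p / \<parallel>p\<parallel>\<^sup>2\<close>.\<close>

lemma Riesz_representation:
  fixes f :: "'a::{real_inner,complete_space} \<Rightarrow> real"
  assumes "bounded_linear f"
  obtains g where "f = (\<lambda>h. inner h g)"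
proof (cases "\<forall>x. f x = 0")
  case True
  then have "f = (\<lambda>h. inner h 0)" by auto
  then show thesis by (rule that)
next
  case False
  interpret f: bounded_linear f by (rule assms)
  obtain z where "f z \<noteq> 0" using False by blast
  define C where "C = {x. f x = 1}"
  have "z /\<^sub>R f z \<in> C" using \<open>f z \<noteq> 0\<close> unfolding C_def by (simp add: f.scaleR)
  then have ne: "C \<noteq> {}" by blast
  have cl: "closed C"
    unfolding C_def by (intro closed_Collect_eq linear_continuous_on assms continuous_on_const)
  have cv: "convex C"
    unfolding C_def by (auto simp: convex_def f.add f.scaleR)
  obtain p where "p \<in> C" and dot: "\<And>y. y \<in> C \<Longrightarrow> 0 \<le> inner p (y - p)"
    using least_norm_point[OF ne cl cv] by blast
  then have p: "f p = 1" unfolding C_def by simp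
  have orth: "inner p v = 0" if "f v = 0" for v
    using dot[of "p + v"] dot[of "p - v"] p that by (simp add: C_def f.add f.diff)
  have "p \<noteq> 0" using p f.zero by auto
  have "f x = inner x (p /\<^sub>R (norm p)\<^sup>2)" for x
  proof -
    have "inner p (x - f x *\<^sub>R p) = 0"
      using p by (intro orth) (simp add: f.diff f.scaleR)
    then show ?thesis
      using \<open>p \<noteq> 0\<close> by (simp add: inner_simps power2_norm_eq_inner inner_commute field_simps)
  qed
  then show thesis by (intro that[of "p /\<^sub>R (norm p)\<^sup>2"]) auto
qed

lemma differentiable_imp_GDERIV_gradient:
  fixes J :: "'a::{real_inner,complete_space} \<Rightarrow> real"
  assumes "J differentiable (at x)"
  shows "GDERIV J x :> gradient J x"
proof -
  obtain D where D: "(J has_derivative D) (at x)"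
    using assms unfolding differentiable_def by blast
  obtain g where "D = (\<lambda>h. inner h g)"
    using Riesz_representation[OF has_derivative_bounded_linear[OF D]] .
  with D have "GDERIV J x :> g" unfolding gderiv_def by simp
  then show ?thesis using gradient_eqI by metis
qed

lemma gradient_eq_0_at_minimum:
  fixes J :: "'a::{real_inner,complete_space} \<Rightarrow> real"
  assumes "J differentiable (at a)" and "\<And>x. J a \<le> J x"
  shows "gradient J a = 0"
proof -
  have "(\<lambda>h. inner h (gradient J a)) = (\<lambda>v. 0)"
    using differentiable_imp_GDERIV_gradient[OF assms(1)] assms(2)
    unfolding gderiv_def by (intro differential_zero_maxmin[of a UNIV]) auto
  then show ?thesis by (metis inner_eq_zero_iff)
qed

text \<open>Along the segment, the function \<open>t \<mapsto> J (x + t *\<^sub>R h) - t * \<langle>h, \<nabla>J x\<rangle> - L/2 * t\<^sup>2 * \<parallel>h\<parallel>\<^sup>2\<close> is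
  nonincreasing for \<open>t \<ge> 0\<close>: by Cauchy-Schwarz its derivative is at most
  \<open>\<parallel>\<nabla>J (x + t *\<^sub>R h) - \<nabla>J x\<parallel> * \<parallel>h\<parallel> - L * t * \<parallel>h\<parallel>\<^sup>2\<close>. The claim compares its values at
  \<open>0\<close> and \<open>1\<close>.\<close>

lemma descent_lemma:
  fixes J :: "'a::{real_inner,complete_space} \<Rightarrow> real"
  assumes diff: "\<And>x. J differentiable (at x)"
    and lip: "\<And>x x'. norm (gradient J x - gradient J x') \<le> L * norm (x - x')"
  shows "J (x + h) \<le> J x + inner h (gradient J x) + L / 2 * (norm h)\<^sup>2"
proof -
  define g where "g = gradient J x"
  define \<phi> where "\<phi> t = J (x + t *\<^sub>R h) - t * inner h g - L / 2 * t\<^sup>2 * (norm h)\<^sup>2" for t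
  have "\<phi> 1 \<le> \<phi> 0"
  proof (rule DERIV_nonpos_imp_nonincreasing[of 0 1 \<phi>])
    fix t :: real assume t: "0 \<le> t" "t \<le> 1"
    define G where "G = gradient J (x + t *\<^sub>R h)"
    have "(J has_derivative (\<lambda>k. inner k G)) (at (x + t *\<^sub>R h))"
      unfolding G_def using differentiable_imp_GDERIV_gradient[OF diff] by (simp add: gderiv_def)
    moreover have "((\<lambda>t. x + t *\<^sub>R h) has_derivative (\<lambda>s. s *\<^sub>R h)) (at t)"
      by (auto intro!: derivative_eq_intros)
    ultimately have "((\<lambda>t. J (x + t *\<^sub>R h)) has_derivative (\<lambda>s. inner (s *\<^sub>R h) G)) (at t)"
      by (rule has_derivative_compose[rotated])
    then have J': "((\<lambda>t. J (x + t *\<^sub>R h)) has_real_derivative inner h G) (at t)"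
      by (rule has_derivative_imp_has_field_derivative) simp
    have "(\<phi> has_real_derivative inner h G - inner h g - L * t * (norm h)\<^sup>2) (at t)"
      unfolding \<phi>_def by (auto intro!: derivative_eq_intros J' simp: power2_eq_square)
    moreover have "inner h G - inner h g \<le> L * t * (norm h)\<^sup>2"
    proof -
      have "inner h G - inner h g \<le> norm h * norm (G - g)"
        using norm_cauchy_schwarz[of h "G - g"] by (simp add: inner_diff_right)
      also have "\<dots> \<le> norm h * (L * (t * norm h))"
        using lip[of "x + t *\<^sub>R h" x] t unfolding G_def g_def by (intro mult_left_mono) auto
      finally show ?thesis by (simp add: power2_eq_square algebra_simps)
    qed
    ultimately show "\<exists>y. (\<phi> has_real_derivative y) (at t) \<and> y \<le> 0"
      by (intro exI[of _ "inner h G - inner h g - L * t * (norm h)\<^sup>2"]) auto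
  qed simp
  then show ?thesis by (simp add: \<phi>_def g_def)
qed

lemma saddle_point_minimax:
  fixes F :: "'a \<Rightarrow> 'b \<Rightarrow> 'c::complete_lattice"
  assumes "a \<in> X" "b \<in> Y"
    and "\<And>y. y \<in> Y \<Longrightarrow> F a y \<le> F a b" and "\<And>x. x \<in> X \<Longrightarrow> F a b \<le> F x b"
  shows "(INF x\<in>X. SUP y\<in>Y. F x y) = F a b" and "(SUP y\<in>Y. INF x\<in>X. F x y) = F a b"
proof -
  show "(INF x\<in>X. SUP y\<in>Y. F x y) = F a b"
  proof (rule antisym)
    show "(INF x\<in>X. SUP y\<in>Y. F x y) \<le> F a b"
      using assms by (auto intro: INF_lower2 SUP_least)
    show "F a b \<le> (INF x\<in>X. SUP y\<in>Y. F x y)"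
      using assms by (auto intro: INF_greatest SUP_upper2)
  qed
  show "(SUP y\<in>Y. INF x\<in>X. F x y) = F a b"
  proof (rule antisym)
    show "(SUP y\<in>Y. INF x\<in>X. F x y) \<le> F a b"
      using assms by (auto intro: SUP_least INF_lower2)
    show "F a b \<le> (SUP y\<in>Y. INF x\<in>X. F x y)"
      using assms by (auto intro: SUP_upper2 INF_greatest)
  qed
qed

theorem theorem2p4:
  fixes J :: "'a::{real_inner,complete_space} \<Rightarrow> real"
    and Y :: "'a set" and L :: real and xs :: 'a
  assumes "Y \<noteq> {}" and "closed Y" and "convex Y"
    and "\<And>x. J differentiable (at x)"
    and "\<And>x x'. norm (gradient J x - gradient J x') \<le> L * norm (x - x')"
    and "\<And>x. J xs \<le> J x"
  shows "(INF x. ereal (J x)) - ereal (L / 2) * (INF y\<in>Y. ereal ((norm y)\<^sup>2))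
           = (INF x. SUP y\<in>Y. ereal (J (x + y) - L / 2 * (norm y)\<^sup>2))
       \<and> (SUP y\<in>Y. INF x. ereal (Lagr J L x y)) = (INF x. SUP y\<in>Y. ereal (Lagr J L x y))
       \<and> (\<exists>xbar. \<exists>ybar\<in>Y. \<forall>x. \<forall>y\<in>Y.
             Lagr J L xbar y \<le> Lagr J L xbar ybar \<and> Lagr J L xbar ybar \<le> Lagr J L x ybar)"
proof -
  obtain p where p: "p \<in> Y" and least: "\<And>y. y \<in> Y \<Longrightarrow> norm p \<le> norm y"
    and dot: "\<And>y. y \<in> Y \<Longrightarrow> 0 \<le> inner p (y - p)"
    using least_norm_point[OF assms(1-3)] by blast
  have growth: "J (xs + h) \<le> J xs + L / 2 * (norm h)\<^sup>2" for h
    using descent_lemma[OF assms(4,5), of xs h] gradient_eq_0_at_minimum[OF assms(4,6)] by simp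
  have max: "Lagr J L (xs - p) y \<le> Lagr J L (xs - p) p" if "y \<in> Y" for y
  proof -
    have "0 \<le> L * inner p (y - p)"
    proof (cases "y = p")
      case False
      \<comment> \<open>A negative \<open>L\<close> is compatible with the Lipschitz bound only on the zero space.\<close>
      have "0 \<le> L * norm (y - p)"
        using order_trans[OF norm_ge_zero assms(5)] .
      with False have "0 \<le> L" by (simp add: zero_le_mult_iff)
      then show ?thesis using dot[OF that] by simp
    qed simp
    moreover have "(norm y)\<^sup>2 = (norm p)\<^sup>2 + 2 * inner p (y - p) + (norm (y - p))\<^sup>2"
      unfolding power2_norm_eq_inner by (simp add: inner_simps inner_commute)
    then have "L / 2 * (norm y)\<^sup>2
        = L / 2 * (norm p)\<^sup>2 + L * inner p (y - p) + L / 2 * (norm (y - p))\<^sup>2"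
      by (simp add: distrib_left)
    ultimately have "L / 2 * (norm (y - p))\<^sup>2 \<le> L / 2 * (norm y)\<^sup>2 - L / 2 * (norm p)\<^sup>2"
      by linarith
    with growth[of "y - p"] show ?thesis
      by (simp add: Lagr_def algebra_simps)
  qed
  have min: "Lagr J L (xs - p) p \<le> Lagr J L x p" for x
    using assms(6) by (simp add: Lagr_def)
  have infsup: "(INF x. SUP y\<in>Y. ereal (Lagr J L x y)) = ereal (Lagr J L (xs - p) p)"
    and supinf: "(SUP y\<in>Y. INF x. ereal (Lagr J L x y)) = ereal (Lagr J L (xs - p) p)"
    using saddle_point_minimax[of "xs - p" UNIV p Y "\<lambda>x y. ereal (Lagr J L x y)"] p max min
    by simp_all
  have "(INF x. ereal (J x)) = ereal (J xs)"
    using assms(6) by (intro antisym INF_lower INF_greatest) auto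
  moreover have "(INF y\<in>Y. ereal ((norm y)\<^sup>2)) = ereal ((norm p)\<^sup>2)"
    using p least by (intro antisym INF_lower INF_greatest) (auto intro: power_mono)
  ultimately have "(INF x. ereal (J x)) - ereal (L / 2) * (INF y\<in>Y. ereal ((norm y)\<^sup>2))
      = (INF x. SUP y\<in>Y. ereal (Lagr J L x y))"
    unfolding infsup by (simp add: Lagr_def)
  moreover have "\<exists>xbar. \<exists>ybar\<in>Y. \<forall>x. \<forall>y\<in>Y.
      Lagr J L xbar y \<le> Lagr J L xbar ybar \<and> Lagr J L xbar ybar \<le> Lagr J L x ybar"
    using p max min by blast
  ultimately show ?thesis
    using infsup supinf by (simp add: Lagr_def)
qed

end
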